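(* Let $A$ be a finite alphabet and let $f : A^{\mathbb{Z}} \to A^{\mathbb{Z}}$ be a cellular automaton. If the generic limit set $\tilde\omega(f)$ is a minimal subshift, then its language $\mathcal{L}(\tilde\omega(f))$ is $\Sigma^0_2$.
   Context: $\mathbb{N}$ contains $0$. For a finite alphabet $A$, the full shift $A^{\mathbb{Z}}$ has the product topology (a compact metrizable space), and the left shift $\sigma$ is given by $\sigma(x)_i = x_{i+1}$. A cellular automaton (CA) on $A^{\mathbb{Z}}$ is a continuous map $f : A^{\mathbb{Z}} \to A^{\mathbb{Z}}$ commuting with $\sigma$. A subset of a topological space is comeager if it contains an intersection of countably many dense open sets. For $x \in A^{\mathbb{Z}}$, $\omega(x)$ is the set of limit points (limits of subsequences) of the forward orbit $(f^t(x))_{t\in\mathbb{N}}$. For $Y \subset A^{\mathbb{Z}}$, the realm of attraction is $\mathfrak{D}(Y) = \{x \in A^{\mathbb{Z}} \mid \omega(x) \subset Y\}$. The generic limit set $\tilde\omega(f)$ is the intersection of all closed sets $C \subset A^{\mathbb{Z}}$ such that $\mathfrak{D}(C)$ is comeager (it is a nonempty subshift and itself has a comeager realm). A subshift is a closed $\sigma$-invariant set $X \subset A^{\mathbb{Z}}$. For $w \in A^*$, $[w] = \{x \in A^{\mathbb{Z}} \mid x_{[0,|w|)} = w\}$. The language of $X$ is $\mathcal{L}(X) = \{w \in A^* \mid [w] \cap X \neq \emptyset\}$, and $\mathcal{L}_n(X) = \mathcal{L}(X) \cap A^n$. A subshift $X$ is minimal if it does not properly contain another nonempty subshift; equivalently,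 for every $w \in \mathcal{L}(X)$ there exists $n \in \mathbb{N}$ such that $w$ occurs in each word of $\mathcal{L}_n(X)$. $\Sigma^0_n$, $\Pi^0_n$ refer to the arithmetical hierarchy of subsets of $\mathbb{N}$, extended to subsets of sets in computable bijection with $\mathbb{N}$ (such as $A^*$). *)

theory Defs
  imports "HOL-Analysis.Analysis"
begin

section \<open>Symbolic dynamics\<close>

text \<open>
  A finite alphabet is a type of class \<open>{finite, discrete_topology}\<close>, and a configuration is a
  function from \<^typ>\<open>int\<close> to it. The library's topology on a function type is the product topology,
  so this is the full shift with its usual topology.
\<close>

definition shift :: "(int \<Rightarrow> 'a) \<Rightarrow> (int \<Rightarrow> 'a)" where
  "shift x = (\<lambda>i. x (i + 1))"

definition cellular_automaton ::
    "((int \<Rightarrow> 'a::{finite, discrete_topology}) \<Rightarrow> (int \<Rightarrow> 'a)) \<Rightarrow> bool" where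
  "cellular_automaton f \<longleftrightarrow> continuous_on UNIV f \<and> f \<circ> shift = shift \<circ> f"

definition comeager :: "'a::topological_space set \<Rightarrow> bool" where
  "comeager S \<longleftrightarrow>
     (\<exists>\<G>. countable \<G> \<and> (\<forall>U\<in>\<G>. open U \<and> closure U = UNIV) \<and> \<Inter>\<G> \<subseteq> S)"

definition omega_limit :: "('a::topological_space \<Rightarrow> 'a) \<Rightarrow> 'a \<Rightarrow> 'a set" where
  "omega_limit f x =
     {y. \<exists>r::nat \<Rightarrow> nat. strict_mono r \<and> (\<lambda>n. (f ^^ r n) x) \<longlonglongrightarrow> y}"

definition realm :: "('a::topological_space \<Rightarrow> 'a) \<Rightarrow> 'a set \<Rightarrow> 'a set" where
  "realm f Y = {x. omega_limit f x \<subseteq> Y}"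

definition generic_limit_set :: "('a::topological_space \<Rightarrow> 'a) \<Rightarrow> 'a set" where
  "generic_limit_set f = \<Inter>{C. closed C \<and> comeager (realm f C)}"

definition subshift :: "(int \<Rightarrow> 'a::{finite, discrete_topology}) set \<Rightarrow> bool" where
  "subshift X \<longleftrightarrow> closed X \<and> shift ` X = X"

definition minimal_subshift :: "(int \<Rightarrow> 'a::{finite, discrete_topology}) set \<Rightarrow> bool" where
  "minimal_subshift X \<longleftrightarrow> subshift X \<and> \<not> (\<exists>Y. subshift Y \<and> Y \<noteq> {} \<and> Y \<subset> X)"

definition cylinder :: "'a list \<Rightarrow> (int \<Rightarrow> 'a) set" where
  "cylinder w = {x. \<forall>i<length w. x (int i) = w ! i}"

definition language :: "(int \<Rightarrow> 'a) set \<Rightarrow> 'a list set" where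
  "language X = {w. cylinder w \<inter> X \<noteq> {}}"


section \<open>Computability and the arithmetical hierarchy\<close>

text \<open>
  \<open>recursive k f\<close> says that \<open>f\<close>, restricted to argument lists of length \<open>k\<close>, is a total recursive
  function of \<open>k\<close> variables. Minimisation is only applied when a zero always exists; by Kleene's
  normal form theorem this still yields every total recursive function. Values of \<open>f\<close> on lists of
  other lengths carry no meaning, which is what rule \<open>ext\<close> expresses.
\<close>

inductive recursive :: "nat \<Rightarrow> (nat list \<Rightarrow> nat) \<Rightarrow> bool" where
  zero: "recursive k (\<lambda>_. 0)"
| succ: "recursive 1 (\<lambda>xs. Suc (xs ! 0))"
| proj: "i < k \<Longrightarrow> recursive k (\<lambda>xs. xs ! i)"
| comp: "recursive (length hs) g \<Longrightarrow> \<forall>h\<in>set hs. recursive k h \<Longrightarrow>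
    recursive k (\<lambda>xs. g (map (\<lambda>h. h xs) hs))"
| prim_rec: "recursive k g \<Longrightarrow> recursive (Suc (Suc k)) h \<Longrightarrow>
    recursive (Suc k) (\<lambda>xs. rec_nat (g (tl xs)) (\<lambda>n r. h (n # r # tl xs)) (hd xs))"
| mu: "recursive (Suc k) g \<Longrightarrow> \<forall>xs. length xs = k \<longrightarrow> (\<exists>n. g (n # xs) = 0) \<Longrightarrow>
    recursive k (\<lambda>xs. LEAST n. g (n # xs) = 0)"
| ext: "recursive k f \<Longrightarrow> \<forall>xs. length xs = k \<longrightarrow> f' xs = f xs \<Longrightarrow> recursive k f'"

definition computable_rel :: "nat \<Rightarrow> (nat list \<Rightarrow> bool) \<Rightarrow> bool" where
  "computable_rel k R \<longleftrightarrow> recursive k (\<lambda>xs. of_bool (R xs))"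

text \<open>
  \<open>Sigma_rel n k R\<close> and \<open>Pi_rel n k R\<close>: the \<open>k\<close>-ary relation \<open>R\<close> is \<open>\<Sigma>\<^sup>0\<close>, respectively \<open>\<Pi>\<^sup>0\<close>, at
  level \<open>n\<close>.
\<close>

fun Sigma_rel :: "nat \<Rightarrow> nat \<Rightarrow> (nat list \<Rightarrow> bool) \<Rightarrow> bool"
  and Pi_rel :: "nat \<Rightarrow> nat \<Rightarrow> (nat list \<Rightarrow> bool) \<Rightarrow> bool" where
  "Sigma_rel 0 k R \<longleftrightarrow> computable_rel k R"
| "Sigma_rel (Suc n) k R \<longleftrightarrow>
     (\<exists>S. Pi_rel n (Suc k) S \<and> (\<forall>xs. length xs = k \<longrightarrow> (R xs \<longleftrightarrow> (\<exists>a. S (a # xs)))))"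
| "Pi_rel 0 k R \<longleftrightarrow> computable_rel k R"
| "Pi_rel (Suc n) k R \<longleftrightarrow>
     (\<exists>S. Sigma_rel n (Suc k) S \<and> (\<forall>xs. length xs = k \<longrightarrow> (R xs \<longleftrightarrow> (\<forall>a. S (a # xs)))))"

definition Sigma_nat :: "nat \<Rightarrow> nat set \<Rightarrow> bool" where
  "Sigma_nat n X \<longleftrightarrow> Sigma_rel n 1 (\<lambda>xs. xs ! 0 \<in> X)"

text \<open>
  Bijective base-\<open>k\<close> numeration, where \<open>k\<close> is the size of the alphabet, first letter least
  significant. For every enumeration \<open>e\<close> of the alphabet it is a computable bijection between words
  and natural numbers.
\<close>

primrec word_code :: "('a::finite \<Rightarrow> nat) \<Rightarrow> 'a list \<Rightarrow> nat" where
  "word_code e [] = 0"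
| "word_code e (a # w) = Suc (e a + CARD('a) * word_code e w)"

lemma bij_word_code:
  fixes e :: "'a::finite \<Rightarrow> nat"
  assumes e: "bij_betw e UNIV {..<CARD('a)}"
  shows "bij (word_code e)"
proof (rule bijI)
  have inj_e: "e a = e b \<longleftrightarrow> a = b" and lt: "e a < CARD('a)" for a b
    using e by (auto simp: bij_betw_def inj_on_def)
  have eq: "a = b \<and> m = n" if "e a + CARD('a) * m = e b + CARD('a) * n" for a b m n
  proof -
    have "e a = e b" using arg_cong[OF that, of "\<lambda>z. z mod CARD('a)"] lt by simp
    then show ?thesis using that inj_e by simp
  qed
  have "word_code e v = word_code e w \<Longrightarrow> v = w" for v w
  proof (induction v arbitrary: w)
    case Nil
    then show ?case by (cases w) auto
  next
    case (Cons a v)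
    then show ?case by (cases w) (auto dest: eq)
  qed
  then show "inj (word_code e)" by (auto intro: injI)
  have "\<exists>w. word_code e w = n" for n
  proof (induction n rule: less_induct)
    case (less n)
    show ?case
    proof (cases n)
      case 0
      then show ?thesis by (auto intro: exI[of _ "[]"])
    next
      case (Suc m)
      have "m mod CARD('a) \<in> e ` UNIV" using e by (simp add: bij_betw_def)
      then obtain a where a: "e a = m mod CARD('a)" by (metis imageE)
      have "m div CARD('a) < n" using Suc by (simp add: div_le_dividend le_imp_less_Suc)
      then obtain w where "word_code e w = m div CARD('a)" using less by blast
      then have "word_code e (a # w) = n" using a Suc by simp
      then show ?thesis by blast
    qed
  qed
  then show "surj (word_code e)" by (metis surjI)
qed

text \<open>
  Any two enumerations of a finite alphabet differ by a permutation of the letters, so the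
  quantifier over \<open>e\<close> only makes the notion independent of an arbitrary choice.
\<close>

definition Sigma_words :: "nat \<Rightarrow> 'a::finite list set \<Rightarrow> bool" where
  "Sigma_words n L \<longleftrightarrow>
     (\<forall>e. bij_betw e UNIV {..<CARD('a)} \<longrightarrow> Sigma_nat n (word_code e ` L))"

end

theory Submission
  imports Defs
begin

text \<open>
  Let \<open>X\<close> be the generic limit set and \<open>w\<close> a word. If \<open>w \<in> language X\<close>, minimality and compactness
  bound the gaps between occurrences of \<open>w\<close>, so \<open>X\<close> lies in a clopen set \<open>U\<close>, the configurations
  with an occurrence of \<open>w\<close> at a position in \<open>[0, n]\<close>. Generically the orbit is eventually in
  \<open>U\<close>, so by Baire there are a word \<open>v\<close> and a time \<open>T\<close> with \<open>f\<^sup>t([v]) \<subseteq> U\<close> for all \<open>t \<ge> T\<close>.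
  Conversely, such \<open>v\<close>, \<open>T\<close>, \<open>n\<close> force a generic point of \<open>[v]\<close> to have all its limit points in
  \<open>U\<close>, so \<open>X\<close> meets \<open>U\<close>. Lengthening \<open>v\<close> lets its code serve as both \<open>n\<close> and \<open>T\<close>, and
  \<open>\<exists>v. \<forall>t. f\<^sup>t([v]) \<subseteq> U\<close> is \<open>\<Sigma>\<^sup>0\<^sub>2\<close> because each inclusion involves only finitely many cells.
  Decidability is expressed arithmetically, a finite configuration being the number with the letters
  as base-\<open>k\<close> digits.
\<close>

section \<open>Recursive functions\<close>

lemma recursive_comp1:
  assumes "recursive 1 (\<lambda>xs. F (xs ! 0))" "recursive k f"
  shows "recursive k (\<lambda>xs. F (f xs))"
  using recursive.comp[of "[f]" "\<lambda>xs. F (xs ! 0)" k] assms by simp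

lemma recursive_comp2:
  assumes "recursive 2 (\<lambda>xs. F (xs ! 0) (xs ! 1))" "recursive k f" "recursive k g"
  shows "recursive k (\<lambda>xs. F (f xs) (g xs))"
  using recursive.comp[of "[f, g]" "\<lambda>xs. F (xs ! 0) (xs ! 1)" k] assms
  by (simp add: numeral_2_eq_2)

lemma recursive_comp3:
  assumes "recursive 3 (\<lambda>xs. F (xs ! 0) (xs ! 1) (xs ! 2))"
    and "recursive k f" "recursive k g" "recursive k h"
  shows "recursive k (\<lambda>xs. F (f xs) (g xs) (h xs))"
  using recursive.comp[of "[f, g, h]" "\<lambda>xs. F (xs ! 0) (xs ! 1) (xs ! 2)" k] assms
  by (simp add: numeral_2_eq_2 numeral_3_eq_3)

text \<open>Binders put their variables in front of the argument list, so outer arguments appear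
  under \<open>tl\<close>; these projections cover such nesting.\<close>

lemma recursive_tl_nth:
  assumes "Suc i < k"
  shows "recursive k (\<lambda>xs. tl xs ! i)"
  by (rule recursive.ext[OF recursive.proj[OF assms]]) (use assms in \<open>simp add: nth_tl\<close>)

lemma recursive_tl_tl_nth:
  assumes "Suc (Suc i) < k"
  shows "recursive k (\<lambda>xs. tl (tl xs) ! i)"
  by (rule recursive.ext[OF recursive.proj[OF assms]]) (use assms in \<open>simp add: nth_tl\<close>)

lemma recursive_tl_tl_tl_nth:
  assumes "Suc (Suc (Suc i)) < k"
  shows "recursive k (\<lambda>xs. tl (tl (tl xs)) ! i)"
  by (rule recursive.ext[OF recursive.proj[OF assms]]) (use assms in \<open>simp add: nth_tl\<close>)

lemmas recursive_vars =
  recursive.proj recursive_tl_nth recursive_tl_tl_nth recursive_tl_tl_tl_nth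

text \<open>\<open>prim_rec\<close> recurses on the head of its arguments; feeding it
  \<open>n xs\<close> followed by all projections of \<open>xs\<close> permits an arbitrary
  recursive bound.\<close>

lemma recursive_rec_nat:
  assumes n: "recursive k n" and g: "recursive k g"
    and h: "recursive (Suc (Suc k)) (\<lambda>ys. h (ys ! 0) (ys ! 1) (tl (tl ys)))"
  shows "recursive k (\<lambda>xs. rec_nat (g xs) (\<lambda>i r. h i r xs) (n xs))"
proof -
  let ?F = "\<lambda>xs. rec_nat (g (tl xs)) (\<lambda>i r. h i r (tl xs)) (hd xs)"
  let ?hs = "n # map (\<lambda>i xs. xs ! i) [0..<k]"
  have "recursive (Suc k) ?F"
    using recursive.prim_rec[OF g h] by simp
  then have "recursive k (\<lambda>xs. ?F (map (\<lambda>h. h xs) ?hs))"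
    by (intro recursive.comp) (auto intro: n recursive.proj)
  then show ?thesis
  proof (rule recursive.ext, intro allI impI)
    fix xs :: "nat list"
    assume "length xs = k"
    then have "map ((\<lambda>h. h xs) \<circ> (\<lambda>i xs. xs ! i)) [0..<k] = xs"
      by (auto intro: nth_equalityI)
    then show "rec_nat (g xs) (\<lambda>i r. h i r xs) (n xs) = ?F (map (\<lambda>h. h xs) ?hs)"
      by simp
  qed
qed

lemma recursive_Suc:
  assumes "recursive k f"
  shows "recursive k (\<lambda>xs. Suc (f xs))"
  by (rule recursive_comp1[OF recursive.succ assms])

lemma recursive_const: "recursive k (\<lambda>_. c)"
  by (induction c) (auto intro: recursive.zero recursive_Suc)

lemma recursive_add:
  assumes "recursive k f" "recursive k g"
  shows "recursive k (\<lambda>xs. f xs + g xs)"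
proof -
  have *: "rec_nat a (\<lambda>i r. Suc r) n = n + a" for a n :: nat
    by (induction n) auto
  have "recursive k (\<lambda>xs. rec_nat (g xs) (\<lambda>i r. Suc r) (f xs))"
    by (intro recursive_rec_nat recursive_Suc recursive.proj assms) auto
  then show ?thesis by (simp add: *)
qed

lemma recursive_mult:
  assumes "recursive k f" "recursive k g"
  shows "recursive k (\<lambda>xs. f xs * g xs)"
proof -
  have *: "rec_nat 0 (\<lambda>i r. r + a) n = n * a" for a n :: nat
    by (induction n) auto
  \<comment> \<open>In two fixed variables the term added under the recursion is a mere projection;
    an arbitrary \<open>g\<close> would have to be re-indexed there.\<close>
  have "recursive 2 (\<lambda>xs. rec_nat 0 (\<lambda>i r. r + xs ! 1) (xs ! 0))"
    by (intro recursive_rec_nat recursive_add recursive.zero recursive_vars) auto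
  then have "recursive 2 (\<lambda>xs. xs ! 0 * xs ! 1)" by (simp add: *)
  from recursive_comp2[OF this assms] show ?thesis .
qed

lemma recursive_pred:
  assumes "recursive k f"
  shows "recursive k (\<lambda>xs. f xs - 1)"
proof -
  have *: "rec_nat 0 (\<lambda>i r. i) n = n - 1" for n :: nat
    by (cases n) auto
  have "recursive k (\<lambda>xs. rec_nat 0 (\<lambda>i r. i) (f xs))"
    by (intro recursive_rec_nat recursive_vars recursive.zero assms) auto
  then show ?thesis by (simp add: *)
qed

lemma recursive_diff:
  assumes "recursive k f" "recursive k g"
  shows "recursive k (\<lambda>xs. f xs - g xs)"
proof -
  have *: "rec_nat a (\<lambda>i r. r - 1) n = a - n" for a n :: nat
    by (induction n) auto
  have "recursive k (\<lambda>xs. rec_nat (f xs) (\<lambda>i r. r - 1) (g xs))"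
    by (intro recursive_rec_nat recursive_pred recursive_vars assms) auto
  then show ?thesis unfolding * .
qed

lemma recursive_power:
  assumes "recursive k f" "recursive k g"
  shows "recursive k (\<lambda>xs. f xs ^ g xs)"
proof -
  have *: "rec_nat 1 (\<lambda>i r. r * a) n = a ^ n" for a n :: nat
    by (induction n) auto
  have "recursive 2 (\<lambda>xs. rec_nat 1 (\<lambda>i r. r * xs ! 0) (xs ! 1))"
    by (intro recursive_rec_nat recursive_mult recursive_const recursive_vars) auto
  then have "recursive 2 (\<lambda>xs. (xs ! 0) ^ (xs ! 1))" unfolding * .
  from recursive_comp2[OF this assms] show ?thesis .
qed

lemma recursive_sum:
  assumes "recursive k n" "recursive (Suc k) (\<lambda>ys. F (ys ! 0) (tl ys))"
  shows "recursive k (\<lambda>xs. \<Sum>i<n xs. F i xs)"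
proof -
  have *: "rec_nat 0 (\<lambda>i r. r + G i) n = (\<Sum>i<n. G i)" for G and n :: nat
    by (induction n) auto
  \<comment> \<open>The recursion step receives the index, the running total and then the old
    arguments; these projections skip the total.\<close>
  let ?hs = "(\<lambda>ys::nat list. ys ! 0) # map (\<lambda>i ys. ys ! Suc (Suc i)) [0..<k]"
  have "recursive (Suc (Suc k)) (\<lambda>ys. (\<lambda>zs. F (zs ! 0) (tl zs)) (map (\<lambda>h. h ys) ?hs))"
    by (rule recursive.comp) (use assms(2) in \<open>auto intro: recursive.proj\<close>)
  then have "recursive (Suc (Suc k)) (\<lambda>ys. F (ys ! 0) (tl (tl ys)))"
  proof (rule recursive.ext, intro allI impI)
    fix ys :: "nat list"
    assume "length ys = Suc (Suc k)"
    then have "map ((\<lambda>h. h ys) \<circ> (\<lambda>i ys. ys ! Suc (Suc i))) [0..<k] = tl (tl ys)"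
      by (auto intro!: nth_equalityI simp: nth_tl)
    then show "F (ys ! 0) (tl (tl ys)) = (\<lambda>zs. F (zs ! 0) (tl zs)) (map (\<lambda>h. h ys) ?hs)"
      by simp
  qed
  then have "recursive k (\<lambda>xs. rec_nat 0 (\<lambda>i r. r + F i xs) (n xs))"
    by (intro recursive_rec_nat recursive_add recursive.zero recursive_vars assms(1)) auto
  then show ?thesis unfolding * .
qed

section \<open>Decidable relations, division and finite tables\<close>

lemma computable_not:
  assumes "computable_rel k P"
  shows "computable_rel k (\<lambda>xs. \<not> P xs)"
proof -
  have "recursive k (\<lambda>xs. 1 - of_bool (P xs))"
    using assms unfolding computable_rel_def by (intro recursive_diff recursive_const)
  also have "(\<lambda>xs. 1 - of_bool (P xs)) = (\<lambda>xs. of_bool (\<not> P xs) :: nat)"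
    by auto
  finally show ?thesis unfolding computable_rel_def .
qed

lemma computable_conj:
  assumes "computable_rel k P" "computable_rel k Q"
  shows "computable_rel k (\<lambda>xs. P xs \<and> Q xs)"
  using recursive_mult[of k "\<lambda>xs. of_bool (P xs)" "\<lambda>xs. of_bool (Q xs)"] assms
  unfolding computable_rel_def by (simp add: of_bool_conj)

lemma computable_imp:
  assumes "computable_rel k P" "computable_rel k Q"
  shows "computable_rel k (\<lambda>xs. P xs \<longrightarrow> Q xs)"
  using computable_not[OF computable_conj[OF assms(1) computable_not[OF assms(2)]]] by simp

lemma computable_le:
  assumes "recursive k f" "recursive k g"
  shows "computable_rel k (\<lambda>xs. f xs \<le> g xs)"
proof -
  have "recursive k (\<lambda>xs. 1 - (f xs - g xs))"
    by (intro recursive_diff recursive_const assms)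
  also have "(\<lambda>xs. 1 - (f xs - g xs)) = (\<lambda>xs. of_bool (f xs \<le> g xs))"
    by auto
  finally show ?thesis unfolding computable_rel_def .
qed

lemma computable_eq:
  assumes "recursive k f" "recursive k g"
  shows "computable_rel k (\<lambda>xs. f xs = g xs)"
  unfolding order.eq_iff by (intro computable_conj computable_le assms)

text \<open>A bounded sum counts the counterexamples, and the count is compared with zero.\<close>

lemma computable_all_less:
  assumes "recursive k n" "computable_rel (Suc k) (\<lambda>ys. P (ys ! 0) (tl ys))"
  shows "computable_rel k (\<lambda>xs. \<forall>i<n xs. P i xs)"
proof -
  have "recursive k (\<lambda>xs. \<Sum>i<n xs. of_bool (\<not> P i xs))"
    using computable_not[OF assms(2)] unfolding computable_rel_def
    by (intro recursive_sum assms(1))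
  from computable_eq[OF this recursive.zero]
  have "computable_rel k (\<lambda>xs. (\<Sum>i<n xs. of_bool (\<not> P i xs)) = (0 :: nat))" .
  also have "(\<lambda>xs. (\<Sum>i<n xs. of_bool (\<not> P i xs)) = (0 :: nat)) = (\<lambda>xs. \<forall>i<n xs. P i xs)"
    by (auto simp: sum_eq_0_iff)
  finally show ?thesis .
qed

lemma computable_ex_less:
  assumes "recursive k n" "computable_rel (Suc k) (\<lambda>ys. P (ys ! 0) (tl ys))"
  shows "computable_rel k (\<lambda>xs. \<exists>i<n xs. P i xs)"
  using computable_not[OF computable_all_less[OF assms(1) computable_not[OF assms(2)]]] by simp

lemma recursive_div:
  assumes "recursive k f" "recursive k g"
  shows "recursive k (\<lambda>xs. f xs div g xs)"
proof -
  \<comment> \<open>For \<open>b > 0\<close> the quotient counts the positive multiples of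
    \<open>b\<close> up to \<open>a\<close>; the first factor enforces
    \<open>a div 0 = 0\<close>.\<close>
  have *: "of_bool (1 \<le> b) * (\<Sum>i<a. of_bool (Suc i * b \<le> a)) = a div b" for a b :: nat
  proof (cases "b = 0")
    case False
    have "{i \<in> {..<a}. Suc i * b \<le> a} = {..<a div b}"
    proof -
      have "Suc i * b \<le> a \<longleftrightarrow> i < a div b" for i
        using False less_eq_div_iff_mult_less_eq[of b "Suc i" a] by (simp add: Suc_le_eq)
      moreover have "i < a" if "i < a div b" for i
        using that div_le_dividend[of a b] by linarith
      ultimately show ?thesis by auto
    qed
    then show ?thesis using False by (simp add: of_bool_def sum.If_cases Int_def)
  qed simp
  have "recursive 2 (\<lambda>xs. of_bool (1 \<le> xs ! 1) * (\<Sum>i<xs ! 0. of_bool (Suc i * xs ! 1 \<le> xs ! 0)))"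
    by (intro recursive_sum recursive_mult recursive_Suc recursive_vars recursive_const
        computable_le[unfolded computable_rel_def]) auto
  then have "recursive 2 (\<lambda>xs. xs ! 0 div xs ! 1)" unfolding * .
  from recursive_comp2[OF this assms] show ?thesis .
qed

lemma recursive_mod:
  assumes "recursive k f" "recursive k g"
  shows "recursive k (\<lambda>xs. f xs mod g xs)"
  unfolding minus_div_mult_eq_mod[symmetric]
  by (intro recursive_diff recursive_mult recursive_div assms)

text \<open>A finite table is a sum of constants times decidable indicators, whatever its entries.
  This lets an arbitrary local rule enter the computation.\<close>

lemma recursive_finite_support:
  assumes "recursive k f" "\<And>c. c \<ge> M \<Longrightarrow> \<phi> c = 0"
  shows "recursive k (\<lambda>xs. \<phi> (f xs))"
proof -
  have "recursive k (\<lambda>xs. \<Sum>c\<in>C. \<phi> c * of_bool (f xs = c))" if "finite C" for C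
    using that
  proof (induction C)
    case (insert c C)
    then show ?case
      unfolding sum.insert[OF insert(1,2)]
      by (intro recursive_add recursive_mult recursive_const assms(1)
          computable_eq[unfolded computable_rel_def])
  qed (simp add: recursive.zero)
  from this[of "{..<M}"] have "recursive k (\<lambda>xs. \<Sum>c<M. \<phi> c * of_bool (f xs = c))" by simp
  also have "(\<lambda>xs. \<Sum>c<M. \<phi> c * of_bool (f xs = c)) = (\<lambda>xs. \<phi> (f xs))"
  proof
    fix xs
    show "(\<Sum>c<M. \<phi> c * of_bool (f xs = c)) = \<phi> (f xs)"
      using assms(2)[of "f xs"] by (cases "f xs < M") (simp_all add: of_bool_def if_distrib cong: if_cong)
  qed
  finally show ?thesis .
qed

lemmas recursive_intros =
  recursive_vars recursive_const recursive_Suc recursive_add recursive_mult recursive_diff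
  recursive_power recursive_div recursive_mod recursive_sum
  computable_conj computable_imp computable_le computable_eq computable_all_less
  computable_ex_less


section \<open>Words and configurations as numbers\<close>

definition digit :: "nat \<Rightarrow> nat \<Rightarrow> nat \<Rightarrow> nat" where
  "digit k y q = y div k ^ q mod k"

definition block :: "nat \<Rightarrow> (nat \<Rightarrow> nat) \<Rightarrow> nat \<Rightarrow> nat" where
  "block k d n = (\<Sum>j<n. d j * k ^ j)"

lemma block_0 [simp]: "block k d 0 = 0"
  by (simp add: block_def)

lemma block_Suc: "block k d (Suc n) = d 0 + k * block k (\<lambda>j. d (Suc j)) n"
  by (simp add: block_def sum.lessThan_Suc_shift sum_distrib_left algebra_simps del: sum.lessThan_Suc)

lemma block_cong: "(\<And>j. j < n \<Longrightarrow> d j = d' j) \<Longrightarrow> block k d n = block k d' n"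
  by (simp add: block_def)

lemma block_less:
  assumes "\<And>j. d j < k"
  shows "block k d n < k ^ n"
  using assms
proof (induction n arbitrary: d)
  case (Suc n)
  have "block k (\<lambda>j. d (Suc j)) n + 1 \<le> k ^ n" using Suc.IH[of "\<lambda>j. d (Suc j)"] Suc.prems by simp
  then have "k * (block k (\<lambda>j. d (Suc j)) n + 1) \<le> k * k ^ n" by (rule mult_le_mono2)
  then show ?case using Suc.prems[of 0] by (simp add: block_Suc)
qed simp

text \<open>Digits below \<open>k\<close> produce no carries, so dividing by \<open>k\<close> strips
  digit 0 and leaves the shifted digits.\<close>

lemma digit_block:
  assumes "\<And>j. d j < k" "q < n"
  shows "digit k (block k d n) q = d q"
  using assms
proof (induction n arbitrary: d q)
  case (Suc n)
  have "0 < k" using Suc.prems(1)[of 0] by simp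
  show ?case
  proof (cases q)
    case 0
    then show ?thesis using Suc.prems(1)[of 0] by (simp add: digit_def block_Suc)
  next
    case (Suc q')
    have "digit k (block k d (Suc n)) q = digit k (block k (\<lambda>j. d (Suc j)) n) q'"
      using Suc.prems(1)[of 0] \<open>0 < k\<close> by (simp add: Suc digit_def block_Suc div_mult2_eq)
    then show ?thesis using Suc.IH[of "\<lambda>j. d (Suc j)" q'] Suc.prems Suc by simp
  qed
qed simp

lemma block_digit: "block k (\<lambda>j. digit k y (p + j)) n = y div k ^ p mod k ^ n"
proof (induction n arbitrary: p)
  case (Suc n)
  show ?case
    using Suc[of "Suc p"]
    by (simp add: block_Suc digit_def mod_mult2_eq div_mult2_eq[symmetric] mult.commute)
qed simp

lemma word_code_eq_block:
  fixes w :: "'a::finite list"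
  shows "word_code e w = block CARD('a) (\<lambda>i. e (w ! i)) (length w) + (\<Sum>i<length w. CARD('a) ^ i)"
proof (induction w)
  case (Cons a w)
  then show ?case
    by (simp add: block_Suc sum.lessThan_Suc_shift sum_distrib_left algebra_simps del: sum.lessThan_Suc)
qed simp

text \<open>Every letter adds at least one to the code. This bounds the search for a length in
  \<open>code_occurs\<close> and lets padding push a code above any threshold.\<close>

lemma length_le_word_code: "length w \<le> word_code e w"
proof (induction w)
  case (Cons a w)
  have "word_code e w \<le> CARD('a) * word_code e w" by simp
  with Cons show ?case unfolding word_code.simps list.size by linarith
qed simp

text \<open>In bijective numeration every digit is one larger than the letter it encodes, hence the
  repunit.\<close>

definition code_occurs :: "nat \<Rightarrow> nat \<Rightarrow> nat \<Rightarrow> nat \<Rightarrow> bool" where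
  "code_occurs k c z p \<longleftrightarrow> (\<exists>l<Suc c. c = z div k ^ p mod k ^ l + (\<Sum>i<l. k ^ i))"

text \<open>By injectivity of \<open>word_code\<close>, a window of whatever length with the same
  code spells \<open>w\<close> itself, so guessing the length creates no false matches.\<close>

lemma code_occurs_word_code:
  fixes e :: "'a::finite \<Rightarrow> nat"
  assumes e: "bij_betw e UNIV {..<CARD('a)}"
  shows "code_occurs CARD('a) (word_code e w) z p \<longleftrightarrow> (\<forall>i<length w. digit CARD('a) z (p + i) = e (w ! i))"
    (is "?L \<longleftrightarrow> ?R")
proof
  let ?d = "\<lambda>i. digit CARD('a) z (p + i)"
  assume ?L
  then obtain l where l: "word_code e w = block CARD('a) ?d l + (\<Sum>i<l. CARD('a) ^ i)"
    by (auto simp: code_occurs_def block_digit)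
  have ed: "e (inv e (?d i)) = ?d i" for i
  proof (rule f_inv_into_f)
    show "?d i \<in> range e" using e by (simp add: bij_betw_def digit_def)
  qed
  let ?u = "map (\<lambda>i. inv e (?d i)) [0..<l]"
  have "word_code e ?u = block CARD('a) ?d l + (\<Sum>i<l. CARD('a) ^ i)"
    unfolding word_code_eq_block[of e ?u] by (simp add: ed block_def)
  then have "?u = w" using l bij_word_code[OF e] by (metis bij_is_inj injD)
  then show ?R using ed by auto
next
  assume ?R
  then have "block CARD('a) (\<lambda>i. e (w ! i)) (length w)
      = block CARD('a) (\<lambda>i. digit CARD('a) z (p + i)) (length w)"
    by (intro block_cong) simp
  then show ?L
    using word_code_eq_block[of e w] length_le_word_code[of w e]
    by (auto simp: code_occurs_def block_digit intro!: exI[of _ "length w"])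
qed

lemma computable_code_occurs:
  assumes "recursive n f" "recursive n g" "recursive n h"
  shows "computable_rel n (\<lambda>xs. code_occurs k (f xs) (g xs) (h xs))"
proof -
  have "computable_rel 3 (\<lambda>xs. code_occurs k (xs ! 0) (xs ! 1) (xs ! 2))"
    unfolding code_occurs_def by (intro recursive_intros) auto
  then show ?thesis
    using assms unfolding computable_rel_def
    by (rule recursive_comp3[where F = "\<lambda>x y z. of_bool (code_occurs k x y z)"])
qed

text \<open>The map \<open>\<phi>\<close> is a one-sided rule of width \<open>m\<close>. Truncation to \<open>L\<close> digits corrupts \<open>m - 1\<close> more
  of the top digits with every step, so \<open>L\<close> is later chosen beyond the light cone.\<close>

definition ca_step :: "nat \<Rightarrow> nat \<Rightarrow> (nat \<Rightarrow> nat) \<Rightarrow> nat \<Rightarrow> nat \<Rightarrow> nat" where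
  "ca_step k m \<phi> L y = block k (\<lambda>q. \<phi> (y div k ^ q mod k ^ m)) L"

lemma recursive_ca_steps:
  assumes "\<And>c. c \<ge> M \<Longrightarrow> \<phi> c = 0"
    and "recursive n f" "recursive n g" "recursive n h"
  shows "recursive n (\<lambda>xs. (ca_step k m \<phi> (f xs) ^^ g xs) (h xs))"
proof -
  have iter: "(F ^^ t) y = rec_nat y (\<lambda>i r. F r) t" for F :: "nat \<Rightarrow> nat" and t y
    by (induction t) auto
  have step: "recursive 2 (\<lambda>xs. ca_step k m \<phi> (xs ! 0) (xs ! 1))"
    unfolding ca_step_def block_def
    by (intro recursive_intros recursive_finite_support[where \<phi> = \<phi>, OF _ assms(1)]) auto
  have "recursive 3 (\<lambda>xs. (ca_step k m \<phi> (xs ! 0) ^^ (xs ! 1)) (xs ! 2))"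
    unfolding iter
    by (intro recursive_rec_nat recursive_vars recursive_comp2[OF step]) auto
  from recursive_comp3[OF this assms(2-4)] show ?thesis .
qed

text \<open>The one-sided rule reads the digits \<open>q\<close> to \<open>q + 2 * r\<close>, a
  window centred at \<open>q + r\<close>. Each step thus moves the cell represented by digit
  \<open>q\<close> by \<open>r\<close> to the right and costs \<open>2 * r\<close> digits at the
  top.\<close>

lemma ca_steps_simulate:
  fixes f :: "(int \<Rightarrow> 'a) \<Rightarrow> int \<Rightarrow> 'a" and e :: "'a \<Rightarrow> nat"
  assumes rule: "\<And>x i. e (f x i) = \<phi> (block k (\<lambda>j. e (x (i - int r + int j))) (2 * r + 1))"
    and bound: "\<And>c. \<phi> c < k"
    and init: "\<And>q. q < L \<Longrightarrow> e (x (int q - s)) = digit k y q"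
    and "q + 2 * r * t < L"
  shows "e ((f ^^ t) x (int q - s + int (r * t)))
    = digit k ((ca_step k (2 * r + 1) \<phi> L ^^ t) y) q"
  using assms(4)
proof (induction t arbitrary: q)
  case 0
  then show ?case using init by simp
next
  case (Suc t)
  let ?Y = "(ca_step k (2 * r + 1) \<phi> L ^^ t) y"
  have "e ((f ^^ t) x (int q - s + int (r * Suc t) - int r + int j)) = digit k ?Y (q + j)"
    if "j < 2 * r + 1" for j
  proof -
    have "q + j + 2 * r * t < L" using that Suc.prems by simp
    then have "e ((f ^^ t) x (int (q + j) - s + int (r * t))) = digit k ?Y (q + j)"
      by (rule Suc.IH)
    then show ?thesis by (simp add: algebra_simps)
  qed
  then have "block k (\<lambda>j. e ((f ^^ t) x (int q - s + int (r * Suc t) - int r + int j))) (2 * r + 1)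
      = block k (\<lambda>j. digit k ?Y (q + j)) (2 * r + 1)"
    by (rule block_cong)
  then have "e ((f ^^ Suc t) x (int q - s + int (r * Suc t)))
      = \<phi> (block k (\<lambda>j. digit k ?Y (q + j)) (2 * r + 1))"
    unfolding funpow.simps o_apply rule by (rule arg_cong)
  also have "\<dots> = \<phi> (?Y div k ^ q mod k ^ (2 * r + 1))"
    by (simp only: block_digit)
  also have "\<dots> = digit k (ca_step k (2 * r + 1) \<phi> L ?Y) q"
    unfolding ca_step_def using Suc.prems bound
    by (intro digit_block[symmetric]) auto
  finally show ?case by simp
qed

text \<open>The bound \<open>b\<close> lets a single universally quantified number range over all pairs of a time \<open>t\<close> and
  a configuration \<open>y\<close>. In \<open>y\<close> the origin is digit \<open>r * t\<close>; after \<open>t\<close> one-sided steps it is digit \<open>0\<close>.\<close>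

definition orbit_test :: "nat \<Rightarrow> nat \<Rightarrow> (nat \<Rightarrow> nat) \<Rightarrow> nat \<Rightarrow> nat \<Rightarrow> nat \<Rightarrow> bool" where
  "orbit_test k r \<phi> b a c \<longleftrightarrow>
    (\<forall>t<Suc b. \<forall>y<Suc b. a \<le> t \<and> code_occurs k a y (r * t) \<longrightarrow>
      (\<exists>p<Suc a. code_occurs k c ((ca_step k (2 * r + 1) \<phi> (2 * r * t + a + c + 1) ^^ t) y) p))"

lemma computable_orbit_test:
  assumes "\<And>c. c \<ge> M \<Longrightarrow> \<phi> c = 0"
  shows "computable_rel 3 (\<lambda>xs. orbit_test k r \<phi> (xs ! 0) (xs ! 1) (xs ! 2))"
  unfolding orbit_test_def
  by (intro recursive_intros computable_code_occurs recursive_ca_steps[where \<phi> = \<phi>, OF assms]) auto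


section \<open>Topology of the full shift\<close>

lemma compact_space_configs:
  "compact_space (euclidean :: (int \<Rightarrow> 'a::{finite, discrete_topology}) topology)"
proof -
  have "compact_space (euclidean :: 'a topology)"
    by (simp add: compact_space_def finite_imp_compact)
  then show ?thesis
    unfolding euclidean_product_topology[symmetric] by (simp add: compact_space_product_topology)
qed

lemma compact_configs: "compact (UNIV :: (int \<Rightarrow> 'a::{finite, discrete_topology}) set)"
  using compact_space_configs by (simp add: compact_space_def)

lemma regular_space_configs:
  "regular_space (euclidean :: (int \<Rightarrow> 'a::{finite, discrete_topology}) topology)"
proof -
  have "Hausdorff_space (euclidean :: 'a topology)"
    by (metis Hausdorff_space_discrete_topology discrete_topology_unique open_discrete open_openin
        topspace_euclidean UNIV_I)
  then have "Hausdorff_space (euclidean :: (int \<Rightarrow> 'a) topology)"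
    unfolding euclidean_product_topology[symmetric] by (simp add: Hausdorff_space_product_topology)
  then show ?thesis
    using compact_space_configs compact_Hausdorff_imp_regular_space by blast
qed

lemma Baire_configs:
  fixes \<C> :: "(int \<Rightarrow> 'a::{finite, discrete_topology}) set set"
  assumes "countable \<C>" "\<And>C. C \<in> \<C> \<Longrightarrow> closed C" "interior (\<Union>\<C>) \<noteq> {}"
  obtains C where "C \<in> \<C>" "interior C \<noteq> {}"
  using Baire_category_alt[of "euclidean :: (int \<Rightarrow> 'a) topology" \<C>] assms
    compact_imp_locally_compact_space[OF compact_space_configs] regular_space_configs
  by auto

section \<open>Finite windows and word occurrences\<close>

lemma open_window:
  fixes y :: "int \<Rightarrow> 'a::discrete_topology"
  assumes "finite I"
  shows "open {x. \<forall>i\<in>I. x i = y i}"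
  using product_topology_basis'[of I "\<lambda>i. {y i}" "\<lambda>i. i"] assms by (simp add: open_discrete)

text \<open>A basic open set constrains only finitely many coordinates, and one symmetric window
  contains them all.\<close>

lemma open_imp_window:
  fixes x :: "int \<Rightarrow> 'a::discrete_topology"
  assumes "open S" "x \<in> S"
  obtains N :: nat where "{y. \<forall>i\<in>{-int N..int N}. y i = x i} \<subseteq> S"
proof -
  obtain X where X: "x \<in> Pi\<^sub>E UNIV X" "finite {i. X i \<noteq> UNIV}" "Pi\<^sub>E UNIV X \<subseteq> S"
    using product_topology_open_contains_basis[of "\<lambda>_. euclidean" UNIV S x] assms
    by (auto simp: open_fun_def)
  obtain N where N: "\<forall>i\<in>{i. X i \<noteq> UNIV}. nat \<bar>i\<bar> \<le> N"
    using finite_nat_set_iff_bounded_le[of "(\<lambda>i. nat \<bar>i\<bar>) ` {i. X i \<noteq> UNIV}"] X(2) by auto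
  have "y \<in> S" if y: "\<forall>i\<in>{-int N..int N}. y i = x i" for y
  proof -
    have "y i \<in> X i" for i
    proof (cases "X i = UNIV")
      case False
      then have "nat \<bar>i\<bar> \<le> N" using N by auto
      then have "i \<in> {-int N..int N}" by (auto simp: abs_le_iff)
      then have "y i = x i" using y by blast
      then show ?thesis using X(1) by (auto simp: PiE_iff)
    qed auto
    then show ?thesis using X(3) by (auto simp: PiE_iff)
  qed
  then show ?thesis using that by blast
qed

definition occurs :: "'a list \<Rightarrow> (int \<Rightarrow> 'a) \<Rightarrow> int \<Rightarrow> bool" where
  "occurs w x p \<longleftrightarrow> (\<forall>i<length w. x (p + int i) = w ! i)"

lemma cylinder_eq_occurs: "cylinder w = {x. occurs w x 0}"
  by (simp add: cylinder_def occurs_def)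

lemma open_occurs:
  fixes w :: "'a::discrete_topology list"
  shows "open {x. occurs w x p}"
proof -
  have "{x. occurs w x p} = {x. \<forall>j\<in>(\<lambda>i. p + int i) ` {..<length w}. x j = w ! nat (j - p)}"
    by (auto simp: occurs_def)
  then show ?thesis
    using open_window[of "(\<lambda>i. p + int i) ` {..<length w}" "\<lambda>j. w ! nat (j - p)"] by simp
qed

lemma closed_occurs:
  fixes w :: "'a::discrete_topology list"
  shows "closed {x. occurs w x p}"
proof -
  have "closed {x. x (p + int i) = w ! i}" for i
  proof -
    have "{x :: int \<Rightarrow> 'a. x (p + int i) = w ! i} = (\<lambda>x. x (p + int i)) -` {w ! i}" by auto
    moreover have "closed {w ! i}" by (simp add: closed_def open_discrete)
    moreover have "continuous_on UNIV (\<lambda>x :: int \<Rightarrow> 'a. x (p + int i))"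
      by (rule continuous_on_product_then_coordinatewise) (rule continuous_on_id)
    ultimately show ?thesis by (metis closed_vimage)
  qed
  then show ?thesis unfolding occurs_def by (intro closed_Collect_all closed_Collect_imp) auto
qed

text \<open>The topology on the alphabet carries no metric instance; sequential compactness is
  transported from \<^typ>\<open>int \<Rightarrow> nat\<close>, which is a metric space.\<close>

lemma configs_convergent_subseq:
  fixes z :: "nat \<Rightarrow> int \<Rightarrow> 'a::{finite, discrete_topology}"
  obtains r y where "strict_mono r" "(\<lambda>n. z (r n)) \<longlonglongrightarrow> y"
proof -
  obtain e :: "'a \<Rightarrow> nat" where e: "inj e"
    using finite_imp_inj_to_nat_seg[of "UNIV :: 'a set"] by auto
  define h :: "(int \<Rightarrow> 'a) \<Rightarrow> int \<Rightarrow> nat" where "h x = (\<lambda>i. e (x i))" for x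
  have "continuous_on UNIV (\<lambda>x :: int \<Rightarrow> 'a. e (x i))" for i
  proof -
    have "continuous_on UNIV e"
      by (simp add: continuous_on_open_vimage open_discrete)
    then show ?thesis
      by (rule continuous_on_compose2[where g = e])
        (auto intro: continuous_on_product_then_coordinatewise continuous_on_id)
  qed
  then have "continuous_on UNIV h"
    unfolding h_def by (intro continuous_on_coordinatewise_then_product)
  then have "seq_compact (range h)"
    using compact_continuous_image compact_configs compact_imp_seq_compact by blast
  then obtain l r where l: "l \<in> range h" "strict_mono r" "((\<lambda>n. h (z n)) \<circ> r) \<longlonglongrightarrow> l"
    by (rule seq_compactE[of _ "\<lambda>n. h (z n)"]) auto
  then obtain y where y: "l = h y" by auto
  have "(\<lambda>n. z (r n)) \<longlonglongrightarrow> y"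
  proof (rule topological_tendstoI)
    fix S :: "(int \<Rightarrow> 'a) set"
    assume "open S" "y \<in> S"
    then obtain N where N: "{x. \<forall>i\<in>{-int N..int N}. x i = y i} \<subseteq> S"
      by (rule open_imp_window)
    let ?T = "{x. \<forall>i\<in>{-int N..int N}. x i = h y i}"
    have "open ?T" "l \<in> ?T"
      using open_window[of "{-int N..int N}" "h y"] y by simp_all
    then have "\<forall>\<^sub>F n in sequentially. ((\<lambda>n. h (z n)) \<circ> r) n \<in> ?T"
      using l(3) topological_tendstoD by blast
    then show "\<forall>\<^sub>F n in sequentially. z (r n) \<in> S"
    proof (rule eventually_mono)
      fix n
      assume "((\<lambda>n. h (z n)) \<circ> r) n \<in> ?T"
      then have "\<forall>i\<in>{-int N..int N}. z (r n) i = y i"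
        using e by (simp add: h_def inj_eq)
      then show "z (r n) \<in> S" using N by auto
    qed
  qed
  with l(2) show ?thesis using that by blast
qed

text \<open>Compactness is applied to the orbit sampled at the infinitely many times of visit to
  \<open>K\<close>.\<close>

lemma omega_limit_meets:
  fixes f :: "(int \<Rightarrow> 'a::{finite, discrete_topology}) \<Rightarrow> int \<Rightarrow> 'a"
  assumes "closed K" and freq: "\<And>T. \<exists>t\<ge>T. (f ^^ t) x \<in> K"
  shows "omega_limit f x \<inter> K \<noteq> {}"
proof -
  define S where "S = {t. (f ^^ t) x \<in> K}"
  have "infinite S"
    unfolding S_def infinite_nat_iff_unbounded_le using freq by blast
  then have s: "strict_mono (enumerate S)" "\<And>n. enumerate S n \<in> S"
    by (auto simp: strict_mono_enumerate enumerate_in_set)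
  obtain r y where r: "strict_mono r" "(\<lambda>n. (f ^^ enumerate S (r n)) x) \<longlonglongrightarrow> y"
    by (rule configs_convergent_subseq[of "\<lambda>n. (f ^^ enumerate S n) x"])
  have "y \<in> omega_limit f x"
    unfolding omega_limit_def using r strict_mono_o[OF s(1) r(1)]
    by (auto intro!: exI[of _ "enumerate S \<circ> r"])
  moreover have "y \<in> K"
    by (rule Lim_in_closed_set[OF assms(1) _ _ r(2)]) (use s(2) in \<open>auto simp: S_def\<close>)
  ultimately show ?thesis by blast
qed

lemma omega_limit_subset_closed:
  assumes "closed K" and ev: "\<And>t. t \<ge> T \<Longrightarrow> (f ^^ t) x \<in> K"
  shows "omega_limit f x \<subseteq> K"
proof
  fix y
  assume "y \<in> omega_limit f x"
  then obtain r where r: "strict_mono r" "(\<lambda>n. (f ^^ r n) x) \<longlonglongrightarrow> y"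
    by (auto simp: omega_limit_def)
  have "\<forall>\<^sub>F n in sequentially. (f ^^ r n) x \<in> K"
    using eventually_ge_at_top[of T]
    by eventually_elim (metis ev order_trans r(1) seq_suble)
  then show "y \<in> K"
    by (rule Lim_in_closed_set[OF assms(1) _ _ r(2)]) simp
qed

section \<open>Comeager sets\<close>

lemma comeager_UNIV: "comeager UNIV"
  unfolding comeager_def by (rule exI[of _ "{}"]) simp

lemma comeagerE:
  assumes "comeager S"
  obtains \<G> where "countable \<G>" "\<forall>U\<in>\<G>. open U \<and> closure U = UNIV" "\<Inter>\<G> \<subseteq> S"
  using assms unfolding comeager_def by (elim exE conjE) (rule that)

lemma comeager_Int:
  assumes "comeager S" "comeager T"
  shows "comeager (S \<inter> T)"
proof -
  obtain \<G> where \<G>: "countable \<G>" "\<forall>U\<in>\<G>. open U \<and> closure U = UNIV"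
    "\<Inter>\<G> \<subseteq> S" by (rule comeagerE[OF assms(1)])
  obtain \<H> where \<H>: "countable \<H>" "\<forall>U\<in>\<H>. open U \<and> closure U = UNIV"
    "\<Inter>\<H> \<subseteq> T" by (rule comeagerE[OF assms(2)])
  show ?thesis
    unfolding comeager_def
  proof (intro exI conjI)
    show "countable (\<G> \<union> \<H>)" using \<G>(1) \<H>(1) by (rule countable_Un)
    show "\<forall>U\<in>\<G> \<union> \<H>. open U \<and> closure U = UNIV" using \<G>(2) \<H>(2) by blast
    show "\<Inter>(\<G> \<union> \<H>) \<subseteq> S \<inter> T" using \<G>(3) \<H>(3) by blast
  qed
qed

lemma comeager_mono: "comeager S \<Longrightarrow> S \<subseteq> T \<Longrightarrow> comeager T"
  unfolding comeager_def by (meson order_trans)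

text \<open>Complements of the dense open sets cover whatever \<open>D\<close> misses, so together
  with the \<open>E T\<close> they cover \<open>S\<close>. By Baire one of these closed sets has
  interior, and the complement of a dense set has none.\<close>

lemma comeager_cover:
  fixes D :: "(int \<Rightarrow> 'a::{finite, discrete_topology}) set"
  assumes "comeager D" "open S" "S \<noteq> {}"
    and "\<And>T :: nat. closed (E T)" "D \<inter> S \<subseteq> (\<Union>T. E T)"
  obtains T where "interior (E T) \<noteq> {}"
proof -
  obtain \<G> where \<G>: "countable \<G>" "\<forall>U\<in>\<G>. open U \<and> closure U = UNIV"
    "\<Inter>\<G> \<subseteq> D" by (rule comeagerE[OF assms(1)])
  have "countable (uminus ` \<G> \<union> range E)" by (simp add: \<G>(1))
  moreover have "S \<subseteq> \<Union>(uminus ` \<G> \<union> range E)"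
  proof
    fix x
    assume "x \<in> S"
    show "x \<in> \<Union>(uminus ` \<G> \<union> range E)"
    proof (cases "x \<in> \<Inter>\<G>")
      case True
      then have "x \<in> D" using \<G>(3) by (rule rev_subsetD)
      then show ?thesis using \<open>x \<in> S\<close> assms(5) by auto
    qed auto
  qed
  then have "S \<subseteq> interior (\<Union>(uminus ` \<G> \<union> range E))"
    using assms(2) by (rule interior_maximal)
  then have "interior (\<Union>(uminus ` \<G> \<union> range E)) \<noteq> {}"
    using assms(3) by blast
  moreover have "closed C" if "C \<in> uminus ` \<G> \<union> range E" for C
    using that \<G>(2) assms(4) by auto
  ultimately obtain C where C: "C \<in> uminus ` \<G> \<union> range E" "interior C \<noteq> {}"
    using Baire_configs[of "uminus ` \<G> \<union> range E"] by metis
  have "interior (- U) = {}" if "U \<in> \<G>" for U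
    using \<G>(2) that by (simp add: interior_complement)
  then have "C \<notin> uminus ` \<G>" using C(2) by auto
  then obtain T where "C = E T" using C(1) by auto
  then show ?thesis using C(2) that[of T] by simp
qed

lemma comeager_meets_open:
  fixes D :: "(int \<Rightarrow> 'a::{finite, discrete_topology}) set"
  assumes "comeager D" "open S" "S \<noteq> {}"
  shows "D \<inter> S \<noteq> {}"
  \<comment> \<open>Were the intersection empty, empty sets would cover it and one of them would
    have interior.\<close>
  using comeager_cover[OF assms, of "\<lambda>_. {}"] by auto


section \<open>Generic limit sets of cellular automata\<close>

text \<open>Forward translations are iterates of \<open>shift\<close>; for negative
  \<open>p\<close>, \<open>x\<close> is a forward translate of its own translate.\<close>

lemma cellular_automaton_translate:
  assumes "cellular_automaton f"
  shows "f (\<lambda>i. x (i + p)) i = f x (i + p)"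
proof -
  have shift: "f (shift x) = shift (f x)" for x
    using assms unfolding cellular_automaton_def by (metis o_apply)
  have nat: "f (\<lambda>i. x (i + int n)) = (\<lambda>i. f x (i + int n))" for x n
  proof (induction n)
    case (Suc n)
    have step: "(\<lambda>i. z (i + int (Suc n))) = shift (\<lambda>i. z (i + int n))" for z :: "int \<Rightarrow> 'a"
      by (simp add: shift_def algebra_simps)
    show ?case unfolding step shift Suc ..
  qed simp
  show ?thesis
  proof (cases "p \<ge> 0")
    case True
    then show ?thesis using nat[of x "nat p"] by (simp add: fun_eq_iff)
  next
    case False
    let ?y = "\<lambda>i. x (i + p)"
    have "(\<lambda>i. ?y (i + int (nat (- p)))) = x" using False by simp
    then have "f x = (\<lambda>i. f ?y (i + int (nat (- p))))" using nat[of ?y "nat (- p)"] by simp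
    then show ?thesis using False by (simp add: fun_eq_iff)
  qed
qed

lemma funpow_translate:
  assumes "cellular_automaton f"
  shows "(f ^^ t) (\<lambda>i. x (i + p)) i = (f ^^ t) x (i + p)"
proof (induction t arbitrary: i)
  case (Suc t)
  have "(f ^^ t) (\<lambda>i. x (i + p)) = (\<lambda>i. (f ^^ t) x (i + p))"
    by (simp add: fun_eq_iff Suc)
  then show ?case by (simp add: cellular_automaton_translate[OF assms])
qed simp

lemma continuous_on_funpow:
  fixes f :: "'a::topological_space \<Rightarrow> 'a"
  assumes "continuous_on UNIV f"
  shows "continuous_on UNIV (f ^^ t)"
proof (induction t)
  case (Suc t)
  have "continuous_on (range (f ^^ t)) f" using assms by (rule continuous_on_subset) simp
  with Suc show ?case unfolding funpow.simps by (rule continuous_on_compose)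
qed (simp add: id_def)

text \<open>Locality half of the Curtis-Hedlund-Lyndon theorem: continuity gives each configuration
  a window that fixes the image at the origin, compactness leaves finitely many, and the largest is
  the radius.\<close>

lemma cellular_automaton_radius:
  fixes f :: "(int \<Rightarrow> 'a::{finite, discrete_topology}) \<Rightarrow> int \<Rightarrow> 'a"
  assumes "cellular_automaton f"
  obtains r :: nat where "\<And>x y. (\<And>i. i \<in> {-int r..int r} \<Longrightarrow> x i = y i) \<Longrightarrow> f x 0 = f y 0"
proof -
  let ?W = "\<lambda>x N. {y :: int \<Rightarrow> 'a. \<forall>i\<in>{-int N..int N}. y i = x i}"
  have "\<exists>N. ?W x N \<subseteq> {y. f y 0 = f x 0}" for x
  proof -
    have "continuous_on UNIV f"
      using assms by (simp add: cellular_automaton_def)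
    then have "continuous_on UNIV (\<lambda>y. f y 0)"
      by (rule continuous_on_product_then_coordinatewise)
    then have "open ((\<lambda>y. f y 0) -` {f x 0})"
      by (rule open_vimage[OF open_discrete])
    moreover have "x \<in> (\<lambda>y. f y 0) -` {f x 0}" by simp
    ultimately obtain N where "?W x N \<subseteq> (\<lambda>y. f y 0) -` {f x 0}"
      by (rule open_imp_window)
    also have "\<dots> = {y. f y 0 = f x 0}" by auto
    finally show ?thesis by (rule exI)
  qed
  then have "\<forall>x. \<exists>N. ?W x N \<subseteq> {y. f y 0 = f x 0}" ..
  from choice[OF this] obtain N where N: "\<forall>x. ?W x (N x) \<subseteq> {y. f y 0 = f x 0}" ..
  have "open (?W x (N x))" for x by (rule open_window) simp
  moreover have "UNIV \<subseteq> (\<Union>x\<in>UNIV. ?W x (N x))" by auto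
  ultimately obtain F where F: "finite F" "UNIV \<subseteq> (\<Union>x\<in>F. ?W x (N x))"
    by (rule compactE_image[OF compact_configs, of UNIV "\<lambda>x. ?W x (N x)"])
  let ?r = "Max (N ` F)"
  have "f x 0 = f y 0" if xy: "\<And>i. i \<in> {-int ?r..int ?r} \<Longrightarrow> x i = y i" for x y
  proof -
    obtain z where z: "z \<in> F" "x \<in> ?W z (N z)" using F(2) by blast
    have "N z \<le> ?r" using z(1) F(1) by simp
    then have "y \<in> ?W z (N z)" using z(2) xy by auto
    then have "f y 0 = f z 0" using N by blast
    moreover have "f x 0 = f z 0" using z(2) N by blast
    ultimately show ?thesis by simp
  qed
  then show ?thesis by (rule that)
qed

lemma cellular_automaton_coded_rule:
  fixes f :: "(int \<Rightarrow> 'a::{finite, discrete_topology}) \<Rightarrow> int \<Rightarrow> 'a"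
  assumes f: "cellular_automaton f" and e: "bij_betw e UNIV {..<CARD('a)}"
  obtains r \<phi> where "\<And>c. \<phi> c < CARD('a)" "\<And>c. c \<ge> CARD('a) ^ (2 * r + 1) \<Longrightarrow> \<phi> c = 0"
    "\<And>x i. e (f x i) = \<phi> (block CARD('a) (\<lambda>j. e (x (i - int r + int j))) (2 * r + 1))"
proof -
  have lt: "e a < CARD('a)" and inv: "inv e (e a) = a" for a
    using e by (auto simp: bij_betw_def)
  obtain r :: nat where r: "\<And>x y. (\<And>i. i \<in> {-int r..int r} \<Longrightarrow> x i = y i) \<Longrightarrow> f x 0 = f y 0"
    using cellular_automaton_radius[OF f] by metis
  let ?m = "2 * r + 1"
  \<comment> \<open>The digits of \<open>c\<close> fill the cells from \<open>-r\<close> to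
    \<open>r\<close>; by the choice of \<open>r\<close> no other cell affects the value at the
    origin.\<close>
  let ?x = "\<lambda>c i. inv e (digit CARD('a) c (nat (i + int r)))"
  \<comment> \<open>The default 0 is itself the code of a letter and gives \<open>\<phi>\<close>
    finite support.\<close>
  define \<phi> where "\<phi> c = (if c < CARD('a) ^ ?m then e (f (?x c) 0) else 0)" for c
  have "e (f x i) = \<phi> (block CARD('a) (\<lambda>j. e (x (i - int r + int j))) ?m)" (is "_ = \<phi> ?c") for x i
  proof -
    have c: "?c < CARD('a) ^ ?m" using lt by (rule block_less)
    have "f (?x ?c) 0 = f (\<lambda>j. x (j + i)) 0"
    proof (rule r)
      fix j
      assume j: "j \<in> {-int r..int r}"
      then have "nat (j + int r) < ?m" by auto
      then have "digit CARD('a) ?c (nat (j + int r)) = e (x (i - int r + int (nat (j + int r))))"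
        by (intro digit_block lt)
      also have "\<dots> = e (x (j + i))" using j by (simp add: algebra_simps)
      finally show "?x ?c j = x (j + i)" by (simp add: inv)
    qed
    then show ?thesis
      using c by (simp add: \<phi>_def cellular_automaton_translate[OF f])
  qed
  moreover have "\<phi> c < CARD('a)" for c using lt by (simp add: \<phi>_def)
  moreover have "\<phi> c = 0" if "c \<ge> CARD('a) ^ ?m" for c using that by (simp add: \<phi>_def)
  ultimately show ?thesis using that by blast
qed

text \<open>The intersection defining the generic limit set may be uncountable. Compactness of the
  complement of \<open>V\<close> leaves finitely many closed sets that already exclude it, and their
  realms meet in a comeager set.\<close>

lemma comeager_omega_limit_subset:
  fixes f :: "(int \<Rightarrow> 'a::{finite, discrete_topology}) \<Rightarrow> int \<Rightarrow> 'a"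
  assumes "open V" "generic_limit_set f \<subseteq> V"
  shows "comeager {x. omega_limit f x \<subseteq> V}"
proof -
  let ?\<C> = "{C. closed C \<and> comeager (realm f C)}"
  have "compact (- V)"
    using compact_Int_closed[OF compact_configs closed_Compl[OF assms(1)]] by simp
  moreover have "- V \<subseteq> \<Union>(uminus ` ?\<C>)"
    using assms(2) unfolding generic_limit_set_def by auto
  moreover have "\<forall>B\<in>uminus ` ?\<C>. open B" by auto
  ultimately obtain \<D> where "\<D> \<subseteq> uminus ` ?\<C>" "finite \<D>" "- V \<subseteq> \<Union>\<D>"
    by (metis (no_types, lifting) compactE)
  then obtain \<F> where \<F>: "\<F> \<subseteq> ?\<C>" "finite \<F>" "- V \<subseteq> \<Union>(uminus ` \<F>)"
    by (metis (no_types, lifting) finite_subset_image)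
  have "comeager (\<Inter>C\<in>\<F>. realm f C)"
    using \<F>(2,1)
  proof (induction \<F>)
    case empty
    then show ?case by (simp add: comeager_UNIV)
  next
    case (insert C \<F>)
    then show ?case by (auto intro: comeager_Int)
  qed
  moreover have "(\<Inter>C\<in>\<F>. realm f C) \<subseteq> {x. omega_limit f x \<subseteq> V}"
    using \<F>(3) by (auto simp: realm_def)
  ultimately show ?thesis by (rule comeager_mono)
qed

section \<open>Gaps between occurrences in a minimal subshift\<close>

lemma subshift_translate:
  assumes "shift ` X = X" "x \<in> X"
  shows "(\<lambda>i. x (i + int n)) \<in> X"
proof (induction n)
  case (Suc n)
  have "(\<lambda>i. x (i + int (Suc n))) = shift (\<lambda>i. x (i + int n))"
    by (simp add: shift_def algebra_simps)
  then show ?case using Suc assms(1) by auto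
qed (use assms in simp)

text \<open>The points of \<open>X\<close> avoiding \<open>w\<close> form a proper subshift of
  \<open>X\<close>, hence none exist. So the open sets of points with \<open>w\<close> at a given
  position cover the compact set \<open>X\<close>, and finitely many positions suffice.\<close>

lemma minimal_subshift_occurs:
  fixes X :: "(int \<Rightarrow> 'a::{finite, discrete_topology}) set"
  assumes X: "minimal_subshift X" and w: "w \<in> language X"
  obtains n :: nat where "\<And>x. x \<in> X \<Longrightarrow> \<exists>p\<le>n. occurs w x (int p)"
proof -
  have X': "closed X" "shift ` X = X" using X by (auto simp: minimal_subshift_def subshift_def)
  define Y where "Y = {x \<in> X. \<forall>p. \<not> occurs w x p}"
  have "closed {x. \<not> occurs w x p}" for p
    using open_occurs[of w p] by (simp add: closed_def Collect_neg_eq)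
  then have "closed {x. \<forall>p. \<not> occurs w x p}" by (intro closed_Collect_all)
  moreover have "Y = X \<inter> {x. \<forall>p. \<not> occurs w x p}" by (auto simp: Y_def)
  ultimately have "closed Y" using X'(1) by auto
  have occ_shift: "occurs w (shift x) p \<longleftrightarrow> occurs w x (p + 1)" for x p
    by (simp add: occurs_def shift_def algebra_simps)
  have all_shift: "(\<forall>p. \<not> occurs w (shift x) p) \<longleftrightarrow> (\<forall>p. \<not> occurs w x p)" for x
    unfolding occ_shift by (metis diff_add_cancel)
  have "shift ` Y = Y"
  proof
    show "shift ` Y \<subseteq> Y" using X'(2) all_shift by (auto simp: Y_def)
    show "Y \<subseteq> shift ` Y"
    proof
      fix x assume x: "x \<in> Y"
      then obtain y where "y \<in> X" "x = shift y" using X'(2) by (auto simp: Y_def)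
      then show "x \<in> shift ` Y" using x all_shift by (auto simp: Y_def)
    qed
  qed
  then have "subshift Y" using \<open>closed Y\<close> by (simp add: subshift_def)
  moreover have "Y \<subset> X" using w by (auto simp: Y_def language_def cylinder_eq_occurs)
  ultimately have "Y = {}" using X by (auto simp: minimal_subshift_def)
  have "compact X" using compact_Int_closed[OF compact_configs X'(1)] by simp
  then obtain J where J: "finite J" "X \<subseteq> (\<Union>p\<in>J. {x. occurs w x p})"
    by (rule compactE_image[of X UNIV "\<lambda>p. {x. occurs w x p}"])
      (use \<open>Y = {}\<close> in \<open>auto simp: Y_def open_occurs\<close>)
  define N where "N = Max (insert 0 ((\<lambda>p. nat \<bar>p\<bar>) ` J))"
  have N: "nat \<bar>p\<bar> \<le> N" if "p \<in> J" for p using that J(1) by (simp add: N_def)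
  have "\<exists>p\<le>2 * N. occurs w x (int p)" if x: "x \<in> X" for x
  proof -
    \<comment> \<open>Positions in \<open>J\<close> may be negative; applying the cover to the
      translate by \<open>N\<close> moves them all between 0 and \<open>2 * N\<close>.\<close>
    have "(\<lambda>i. x (i + int N)) \<in> X" using subshift_translate[OF X'(2) x] .
    then obtain p where p: "p \<in> J" "occurs w (\<lambda>i. x (i + int N)) p" using J(2) by auto
    have "occurs w x (p + int N)" using p(2) by (simp add: occurs_def algebra_simps)
    then show ?thesis using N[OF p(1)] by (intro exI[of _ "nat (p + int N)"]) auto
  qed
  then show ?thesis by (rule that)
qed

lemma occurs_prefix:
  assumes "occurs (u @ v) x p"
  shows "occurs u x p"
  unfolding occurs_def
proof (intro allI impI)
  fix i
  assume "i < length u"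
  then show "x (p + int i) = u ! i"
    using assms by (simp add: occurs_def nth_append)
qed

lemma language_generic_limit_set_iff:
  fixes f :: "(int \<Rightarrow> 'a::{finite, discrete_topology}) \<Rightarrow> int \<Rightarrow> 'a" and e :: "'a \<Rightarrow> nat"
  assumes f: "cellular_automaton f" and X: "minimal_subshift (generic_limit_set f)"
  shows "w \<in> language (generic_limit_set f) \<longleftrightarrow>
    (\<exists>v. \<forall>t\<ge>word_code e v. \<forall>x. occurs v x 0 \<longrightarrow>
      (\<exists>p\<le>word_code e v. occurs w ((f ^^ t) x) (int p)))" (is "?L \<longleftrightarrow> ?R")
proof
  let ?X = "generic_limit_set f"
  let ?U = "\<lambda>n. {x. \<exists>p\<le>n. occurs w x (int p)}"
  have openU: "open (?U n)" for n
    unfolding Collect_ex_eq Collect_conj_eq using open_occurs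
    by (intro open_UN) auto
  have closedU: "closed (?U n)" for n
  proof -
    have "?U n = (\<Union>p\<in>{..n}. {x. occurs w x (int p)})" by auto
    moreover have "closed (\<Union>p\<in>{..n}. {x. occurs w x (int p)})"
      by (intro closed_UN ballI closed_occurs) simp
    ultimately show ?thesis by (simp only:)
  qed
  {
    assume ?L
    then obtain n where n: "\<And>x. x \<in> ?X \<Longrightarrow> \<exists>p\<le>n. occurs w x (int p)"
      using minimal_subshift_occurs[OF X] by blast
    let ?D = "{x. omega_limit f x \<subseteq> ?U n}"
    have "comeager ?D" using n by (intro comeager_omega_limit_subset openU) auto
    let ?E = "\<lambda>T. {x. \<forall>t\<ge>T. (f ^^ t) x \<in> ?U n}"
    have "closed (?E T)" for T
    proof -
      have "closed ((f ^^ t) -` ?U n)" for t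
        using continuous_on_funpow f closedU
        by (intro closed_vimage) (auto simp: cellular_automaton_def)
      moreover have "?E T = (\<Inter>t\<in>{T..}. (f ^^ t) -` ?U n)" by auto
      ultimately show ?thesis by (simp only:) (intro closed_INT ballI)
    qed
    \<comment> \<open>An orbit outside the open set \<open>?U n\<close> infinitely often has a limit
      point outside it, so on \<open>?D\<close> the orbit stays inside from some time on.\<close>
    moreover have "?D \<inter> UNIV \<subseteq> (\<Union>T. ?E T)"
    proof
      fix x assume "x \<in> ?D \<inter> UNIV"
      then have "omega_limit f x \<inter> - ?U n = {}" by auto
      then have "\<not> (\<forall>T. \<exists>t\<ge>T. (f ^^ t) x \<in> - ?U n)"
        using omega_limit_meets[OF closed_Compl[OF openU[of n]], of f x] by blast
      then obtain T where "\<not> (\<exists>t\<ge>T. (f ^^ t) x \<in> - ?U n)" unfolding not_all by (rule exE)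
      then have "x \<in> ?E T" by auto
      then show "x \<in> (\<Union>T. ?E T)" by (rule UN_I[OF UNIV_I])
    qed
    ultimately obtain T where "interior (?E T) \<noteq> {}"
      by (rule comeager_cover[OF \<open>comeager ?D\<close> open_UNIV UNIV_not_empty, of ?E])
    then obtain x0 where "x0 \<in> interior (?E T)" by blast
    then obtain N where "{y. \<forall>i\<in>{-int N..int N}. y i = x0 i} \<subseteq> interior (?E T)"
      by (rule open_imp_window[OF open_interior])
    then have N: "{y. \<forall>i\<in>{-int N..int N}. y i = x0 i} \<subseteq> ?E T"
      using interior_subset by (rule subset_trans)
    define u where "u = map (\<lambda>i. x0 (int i - int N)) [0..<2 * N + 1]"
    \<comment> \<open>The padding, in an arbitrary letter, only shrinks the cylinder of
      \<open>u\<close>; it raises the code above the gap \<open>n\<close>, the translation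
      \<open>N\<close> and the time \<open>T\<close> together.\<close>
    define v where "v = u @ replicate (n + N + T) undefined"
    have long: "n + N + T \<le> word_code e v"
      using length_le_word_code[of v e] by (simp add: v_def)
    have "\<exists>p\<le>word_code e v. occurs w ((f ^^ t) x) (int p)"
      if t: "t \<ge> word_code e v" and x: "occurs v x 0" for t x
    proof -
      \<comment> \<open>Translation by \<open>N\<close> recentres the window, so that
        \<open>?y\<close> agrees with \<open>x0\<close> on it; an occurrence at \<open>p\<close> for
        \<open>?y\<close> is one at \<open>p + N\<close> for \<open>x\<close>.\<close>
      let ?y = "\<lambda>i. x (i + int N)"
      have u: "x (int i) = x0 (int i - int N)" if "i < 2 * N + 1" for i
        using occurs_prefix[OF x[unfolded v_def]] that
        by (simp add: occurs_def u_def del: upt_Suc)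
      have "?y i = x0 i" if "i \<in> {-int N..int N}" for i
        using u[of "nat (i + int N)"] that by auto
      then have "?y \<in> {y. \<forall>i\<in>{-int N..int N}. y i = x0 i}" by blast
      then have "?y \<in> ?E T" by (rule subsetD[OF N])
      moreover have "T \<le> t" using t long by linarith
      ultimately obtain p where p: "p \<le> n" "occurs w ((f ^^ t) ?y) (int p)" by auto
      have "occurs w ((f ^^ t) x) (int (p + N))"
        using p(2) by (simp add: occurs_def funpow_translate[OF f] algebra_simps)
      then show ?thesis using p(1) long by (intro exI[of _ "p + N"]) auto
    qed
    then show ?R by blast
  }
  {
    assume ?R
    then obtain v where v: "\<And>t x. t \<ge> word_code e v \<Longrightarrow> occurs v x 0 \<Longrightarrow>
      (f ^^ t) x \<in> ?U (word_code e v)" by auto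
    let ?U' = "?U (word_code e v)"
    \<comment> \<open>Otherwise a generic point of \<open>cylinder v\<close> has all its limit
      points outside \<open>?U'\<close>, whereas \<open>v\<close> forces them into
      \<open>?U'\<close>, and at least one exists.\<close>
    have "\<not> ?X \<subseteq> - ?U'"
    proof
      assume "?X \<subseteq> - ?U'"
      then have "comeager {x. omega_limit f x \<subseteq> - ?U'}"
        using closedU by (intro comeager_omega_limit_subset) auto
      moreover have "(\<lambda>i. v ! nat i) \<in> {x. occurs v x 0}" by (simp add: occurs_def)
      ultimately have "{x. omega_limit f x \<subseteq> - ?U'} \<inter> {x. occurs v x 0} \<noteq> {}"
        using comeager_meets_open open_occurs by blast
      then obtain x where x: "omega_limit f x \<subseteq> - ?U'" "occurs v x 0" by blast
      have "omega_limit f x \<subseteq> ?U'"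
        using v x(2) by (intro omega_limit_subset_closed closedU)
      moreover have "omega_limit f x \<noteq> {}"
        using omega_limit_meets[of UNIV f x] by auto
      ultimately show False using x(1) by blast
    qed
    then obtain x p where x: "x \<in> ?X" "occurs w x (int p)" by blast
    have "(\<lambda>i. x (i + int p)) \<in> ?X"
      using X x(1) by (intro subshift_translate) (auto simp: minimal_subshift_def subshift_def)
    moreover have "occurs w (\<lambda>i. x (i + int p)) 0"
      using x(2) by (simp add: occurs_def algebra_simps)
    ultimately show ?L by (auto simp: language_def cylinder_eq_occurs)
  }
qed


section \<open>The arithmetical bound\<close>

text \<open>Both tests read only digits still correct at their time, so agreement of
  \<open>x\<close> and \<open>y\<close> on the \<open>L\<close> cells from \<open>- r * t\<close> on
  suffices.\<close>

lemma code_occurs_iff_occurs: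
  fixes f :: "(int \<Rightarrow> 'a::finite) \<Rightarrow> int \<Rightarrow> 'a" and e :: "'a \<Rightarrow> nat"
  assumes e: "bij_betw e UNIV {..<CARD('a)}"
    and bound: "\<And>c. \<phi> c < CARD('a)"
    and rule: "\<And>x i. e (f x i) = \<phi> (block CARD('a) (\<lambda>j. e (x (i - int r + int j))) (2 * r + 1))"
    and L: "L = 2 * r * t + word_code e v + word_code e w + 1"
    and agree: "\<And>q. q < L \<Longrightarrow> e (x (int q - int (r * t))) = digit CARD('a) y q"
  shows "code_occurs CARD('a) (word_code e v) y (r * t) \<longleftrightarrow> occurs v x 0"
    and "p \<le> word_code e v \<Longrightarrow>
      code_occurs CARD('a) (word_code e w) ((ca_step CARD('a) (2 * r + 1) \<phi> L ^^ t) y) p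
      \<longleftrightarrow> occurs w ((f ^^ t) x) (int p)"
proof -
  have inj: "e a = e b \<longleftrightarrow> a = b" for a b
    using e by (auto simp: bij_betw_def inj_on_def)
  have "digit CARD('a) y (r * t + i) = e (x (int i))" if "i < length v" for i
    using agree[of "r * t + i"] that length_le_word_code[of v e] by (simp add: L)
  then show "code_occurs CARD('a) (word_code e v) y (r * t) \<longleftrightarrow> occurs v x 0"
    by (simp add: code_occurs_word_code[OF e] occurs_def inj)
  assume p: "p \<le> word_code e v"
  have "digit CARD('a) ((ca_step CARD('a) (2 * r + 1) \<phi> L ^^ t) y) (p + i)
      = e ((f ^^ t) x (int p + int i))" if "i < length w" for i
  proof -
    \<comment> \<open>The codes of \<open>v\<close> and \<open>w\<close> in \<open>L\<close> make
      room for \<open>p\<close> and for \<open>i\<close>, respectively.\<close>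
    have "p + i + 2 * r * t < L"
      using p that length_le_word_code[of w e] by (simp add: L)
    from ca_steps_simulate[where e = e and f = f and \<phi> = \<phi>, OF rule bound agree this]
    show ?thesis by simp
  qed
  then show "code_occurs CARD('a) (word_code e w) ((ca_step CARD('a) (2 * r + 1) \<phi> L ^^ t) y) p
      \<longleftrightarrow> occurs w ((f ^^ t) x) (int p)"
    by (simp add: code_occurs_word_code[OF e] occurs_def inj)
qed

text \<open>Only a finite piece matters, so a configuration can be truncated to a number in one
  direction and a number decoded to a configuration in the other.\<close>

lemma all_orbit_test_iff:
  fixes f :: "(int \<Rightarrow> 'a::finite) \<Rightarrow> int \<Rightarrow> 'a" and e :: "'a \<Rightarrow> nat"
  assumes e: "bij_betw e UNIV {..<CARD('a)}"
    and bound: "\<And>c. \<phi> c < CARD('a)"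
    and rule: "\<And>x i. e (f x i) = \<phi> (block CARD('a) (\<lambda>j. e (x (i - int r + int j))) (2 * r + 1))"
  shows "(\<forall>b. orbit_test CARD('a) r \<phi> b (word_code e v) (word_code e w)) \<longleftrightarrow>
    (\<forall>t\<ge>word_code e v. \<forall>x. occurs v x 0 \<longrightarrow>
      (\<exists>p\<le>word_code e v. occurs w ((f ^^ t) x) (int p)))" (is "?L \<longleftrightarrow> ?R")
proof
  let ?a = "word_code e v" and ?c = "word_code e w" and ?k = "CARD('a)"
  note agree = code_occurs_iff_occurs[where e = e and f = f and \<phi> = \<phi>, OF e bound rule refl]
  have e_range: "e a < ?k" for a using e by (auto simp: bij_betw_def)
  {
    assume L: ?L
    show ?R
    proof (intro allI impI)
      fix t x
      assume t: "?a \<le> t" and x: "occurs v x 0"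
      let ?N = "2 * r * t + ?a + ?c + 1"
      define y where "y = block ?k (\<lambda>q. e (x (int q - int (r * t)))) ?N"
      have y: "e (x (int q - int (r * t))) = digit ?k y q" if "q < ?N" for q
        unfolding y_def using e_range that by (intro digit_block[symmetric])
      have "code_occurs ?k ?a y (r * t)" using agree(1)[OF y] x by simp
      \<comment> \<open>The bound \<open>max t y\<close> admits both the time and the
        number.\<close>
      moreover have "t < Suc (max t y)" "y < Suc (max t y)" by simp_all
      moreover have "orbit_test ?k r \<phi> (max t y) ?a ?c" using L ..
      ultimately obtain p where p:
        "p < Suc ?a" "code_occurs ?k ?c ((ca_step ?k (2 * r + 1) \<phi> ?N ^^ t) y) p"
        using t unfolding orbit_test_def by blast
      have "code_occurs ?k ?c ((ca_step ?k (2 * r + 1) \<phi> ?N ^^ t) y) p \<longleftrightarrow> occurs w ((f ^^ t) x) (int p)"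
        by (rule agree(2)) (use y p(1) in auto)
      then show "\<exists>p\<le>?a. occurs w ((f ^^ t) x) (int p)"
        using p by (intro exI[of _ p]) simp
    qed
  }
  {
    assume R: ?R
    show ?L
      unfolding orbit_test_def
    proof (intro allI impI)
      fix b t y
      assume y: "?a \<le> t \<and> code_occurs ?k ?a y (r * t)"
      let ?N = "2 * r * t + ?a + ?c + 1"
      \<comment> \<open>\<open>nat\<close> sends all cells left of \<open>- r * t\<close> to digit
        0; agreement is claimed only from that cell on.\<close>
      define x where "x = (\<lambda>i. inv e (digit ?k y (nat (i + int (r * t)))))"
      have "e (inv e (digit ?k y q)) = digit ?k y q" for q
        by (rule f_inv_into_f) (use e in \<open>simp add: bij_betw_def digit_def\<close>)
      then have x: "e (x (int q - int (r * t))) = digit ?k y q" if "q < ?N" for q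
        by (simp add: x_def)
      have "occurs v x 0" using agree(1)[OF x] y by simp
      then obtain p where p: "p \<le> ?a" "occurs w ((f ^^ t) x) (int p)" using R y by blast
      have "code_occurs ?k ?c ((ca_step ?k (2 * r + 1) \<phi> ?N ^^ t) y) p \<longleftrightarrow> occurs w ((f ^^ t) x) (int p)"
        by (rule agree(2)) (use x p(1) in auto)
      then show "\<exists>p<Suc ?a. code_occurs ?k ?c ((ca_step ?k (2 * r + 1) \<phi> ?N ^^ t) y) p"
        using p by (intro exI[of _ p]) simp
    qed
  }
qed

theorem proposition1:
  fixes f :: "(int \<Rightarrow> 'a::{finite, discrete_topology}) \<Rightarrow> (int \<Rightarrow> 'a)"
  assumes "cellular_automaton f"
    and "minimal_subshift (generic_limit_set f)"
  shows "Sigma_words 2 (language (generic_limit_set f))"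
  unfolding Sigma_words_def
proof (intro allI impI)
  fix e :: "'a \<Rightarrow> nat"
  assume e: "bij_betw e UNIV {..<CARD('a)}"
  let ?L = "language (generic_limit_set f)"
  obtain r \<phi> where \<phi>: "\<And>c. \<phi> c < CARD('a)" "\<And>c. c \<ge> CARD('a) ^ (2 * r + 1) \<Longrightarrow> \<phi> c = 0"
    "\<And>x i. e (f x i) = \<phi> (block CARD('a) (\<lambda>j. e (x (i - int r + int j))) (2 * r + 1))"
    by (rule cellular_automaton_coded_rule[OF assms(1) e]) blast
  have bij: "bij (word_code e)" using e by (rule bij_word_code)
  have L: "c \<in> word_code e ` ?L \<longleftrightarrow> (\<exists>a. \<forall>b. orbit_test CARD('a) r \<phi> b a c)" for c
  proof -
    obtain w where w: "c = word_code e w" using bij by (metis bij_pointE)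
    have "c \<in> word_code e ` ?L \<longleftrightarrow> w \<in> ?L"
      using bij by (simp add: w inj_image_mem_iff bij_is_inj)
    also have "\<dots> \<longleftrightarrow> (\<exists>v. \<forall>b. orbit_test CARD('a) r \<phi> b (word_code e v) c)"
      unfolding language_generic_limit_set_iff[OF assms, of w e] w
      by (simp only: all_orbit_test_iff[where e = e and f = f and \<phi> = \<phi>, OF e \<phi>(1,3)])
    \<comment> \<open>Surjectivity of \<open>word_code\<close> turns the quantifier over words into
      one over numbers.\<close>
    also have "\<dots> \<longleftrightarrow> (\<exists>a. \<forall>b. orbit_test CARD('a) r \<phi> b a c)"
      using bij by (metis bij_pointE)
    finally show ?thesis .
  qed
  \<comment> \<open>Each level of the hierarchy quantifies over the head of the list, hence the
    order \<open>b\<close>, \<open>a\<close>, \<open>c\<close>: first \<open>b\<close> is bound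
    universally, then \<open>a\<close> existentially.\<close>
  have "Sigma_rel 0 3 (\<lambda>xs. orbit_test CARD('a) r \<phi> (xs ! 0) (xs ! 1) (xs ! 2))"
    using computable_orbit_test[where \<phi> = \<phi> and k = "CARD('a)" and r = r, OF \<phi>(2)] by simp
  then have "Pi_rel 1 2 (\<lambda>xs. \<forall>b. orbit_test CARD('a) r \<phi> b (xs ! 0) (xs ! 1))"
    unfolding One_nat_def Pi_rel.simps
    by (intro exI[of _ "\<lambda>xs. orbit_test CARD('a) r \<phi> (xs ! 0) (xs ! 1) (xs ! 2)"])
      (simp add: numeral_3_eq_3 numeral_2_eq_2)
  then have "Sigma_rel 2 1 (\<lambda>xs. \<exists>a. \<forall>b. orbit_test CARD('a) r \<phi> b a (xs ! 0))"
    unfolding numeral_2_eq_2 Sigma_rel.simps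
    by (intro exI[of _ "\<lambda>xs. \<forall>b. orbit_test CARD('a) r \<phi> b (xs ! 0) (xs ! 1)"])
      (simp add: numeral_2_eq_2 del: Pi_rel.simps)
  then show "Sigma_nat 2 (word_code e ` ?L)"
    unfolding Sigma_nat_def L .
qed

end
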